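(* Let $k \in \mathbb{N}$, $k \geq 1$. Then there exists a polynomial $$A_{k-1}(n;x) = a_{k-1}(n)\,x^{k-1} + a_{k-2}(n)\,x^{k-2} + \cdots + a_1(n)\,x + a_0(n)$$ in $x$, whose coefficients $a_j(n)$, $0 \le j \le k-1$, are polynomials in $n$ with integer coefficients, such that for every $N \in \mathbb{N}$ the identity $$\sum_{n=0}^{N-1} n!\,\bigl[\,n^k x^k + U_k(x)\,\bigr]\,x^n \;=\; V_k(x) + N!\,x^N A_{k-1}(N;x)$$ holds (as a polynomial identity in $x$, hence for $x$ in $\mathbb{R}$ and in every $\mathbb{Q}_p$), where $$U_k(x) = x\,A_{k-1}(1;x) - A_{k-1}(0;x), \qquad V_k(x) = -A_{k-1}(0;x).$$
   Context: $n! = 1\cdot 2\cdots n$ with $0! = 1$. $\mathbb{Q}_p$ denotes the field of $p$-adic numbers for a prime $p$. *)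

theory Defs
  imports
    "HOL-Computational_Algebra.Computational_Algebra"
    "Berlekamp_Zassenhaus.Finite_Field"
begin

section \<open>p-adic numbers\<close>

text \<open>
  The prime \<open>p\<close> is carried by a type \<open>'p\<close> of class \<^class>\<open>prime_card\<close>, i.e. \<open>p = CARD('p)\<close>.
  The ring of \<open>p\<close>-adic integers is the inverse limit of the rings \<open>\<int>/p\<^sup>n\<int>\<close>, residues being
  represented by their canonical representatives; the \<open>p\<close>-adic numbers are its field of fractions.
\<close>

typedef (overloaded) ('p::prime_card) padic_int =
  "{f :: nat \<Rightarrow> int. \<forall>n. f (Suc n) mod int CARD('p) ^ n = f n}"
  morphisms residue Abs_padic_int
  by (rule exI[of _ "\<lambda>_. 0"]) simp

setup_lifting type_definition_padic_int

lemma residue_Suc_mod: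
  "residue (x :: 'p::prime_card padic_int) (Suc n) mod int CARD('p) ^ n = residue x n"
  using residue[of x] by simp

lemma residue_mod:
  "residue (x :: 'p::prime_card padic_int) n mod int CARD('p) ^ n = residue x n"
  by (metis residue_Suc_mod mod_mod_trivial)

lemma residue_add_mod:
  "residue (x :: 'p::prime_card padic_int) (n + m) mod int CARD('p) ^ n = residue x n"
proof (induction m)
  case 0
  then show ?case by (simp add: residue_mod)
next
  case (Suc m)
  have "residue x (n + Suc m) mod int CARD('p) ^ n
      = residue x (Suc (n + m)) mod int CARD('p) ^ (n + m) mod int CARD('p) ^ n"
    by (simp add: mod_mod_cancel power_add)
  with Suc show ?case by (simp add: residue_Suc_mod)
qed

lemma padic_int_eqI: "(\<And>n. residue x n = residue y n) \<Longrightarrow> x = y"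
  by (simp add: residue_inject[symmetric] fun_eq_iff)

instantiation padic_int :: (prime_card) comm_ring_1
begin

lift_definition zero_padic_int :: "'a padic_int" is "\<lambda>_. 0" by simp

lift_definition one_padic_int :: "'a padic_int" is "\<lambda>n. 1 mod int CARD('a) ^ n"
  by (simp add: mod_mod_cancel)

lift_definition plus_padic_int :: "'a padic_int \<Rightarrow> 'a padic_int \<Rightarrow> 'a padic_int"
  is "\<lambda>f g n. (f n + g n) mod int CARD('a) ^ n"
  by (simp add: mod_mod_cancel) (metis mod_add_eq)

lift_definition times_padic_int :: "'a padic_int \<Rightarrow> 'a padic_int \<Rightarrow> 'a padic_int"
  is "\<lambda>f g n. (f n * g n) mod int CARD('a) ^ n"
  by (simp add: mod_mod_cancel) (metis mod_mult_eq)

lift_definition uminus_padic_int :: "'a padic_int \<Rightarrow> 'a padic_int"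
  is "\<lambda>f n. (- f n) mod int CARD('a) ^ n"
  by (simp add: mod_mod_cancel) (metis mod_minus_eq)

lift_definition minus_padic_int :: "'a padic_int \<Rightarrow> 'a padic_int \<Rightarrow> 'a padic_int"
  is "\<lambda>f g n. (f n - g n) mod int CARD('a) ^ n"
  by (simp add: mod_mod_cancel) (metis mod_diff_eq)

instance
proof
  fix a b c :: "'a padic_int"
  show "a * b * c = a * (b * c)"
    by (rule padic_int_eqI) (simp add: times_padic_int.rep_eq mod_simps mult.assoc)
  show "a * b = b * a"
    by (rule padic_int_eqI) (simp add: times_padic_int.rep_eq mult.commute)
  show "1 * a = a"
    by (rule padic_int_eqI)
      (simp add: times_padic_int.rep_eq one_padic_int.rep_eq mod_simps residue_mod)
  show "a + b + c = a + (b + c)"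
    by (rule padic_int_eqI) (simp add: plus_padic_int.rep_eq mod_simps add.assoc)
  show "a + b = b + a"
    by (rule padic_int_eqI) (simp add: plus_padic_int.rep_eq add.commute)
  show "0 + a = a"
    by (rule padic_int_eqI)
      (simp add: plus_padic_int.rep_eq zero_padic_int.rep_eq residue_mod)
  show "- a + a = 0"
    by (rule padic_int_eqI)
      (simp add: plus_padic_int.rep_eq uminus_padic_int.rep_eq zero_padic_int.rep_eq mod_simps)
  show "a - b = a + - b"
    by (rule padic_int_eqI)
      (simp add: plus_padic_int.rep_eq uminus_padic_int.rep_eq minus_padic_int.rep_eq mod_simps)
  show "(a + b) * c = a * c + b * c"
    by (rule padic_int_eqI)
      (simp add: plus_padic_int.rep_eq times_padic_int.rep_eq mod_simps distrib_right)
  have "residue (0 :: 'a padic_int) 1 \<noteq> residue 1 1"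
    using prime_gt_1_nat[OF prime_card[where 'a = 'a]]
    by (simp add: zero_padic_int.rep_eq one_padic_int.rep_eq)
  then show "(0 :: 'a padic_int) \<noteq> 1"
    by metis
qed

end

instance padic_int :: (prime_card) idom
proof
  fix a b :: "'a padic_int"
  let ?p = "int CARD('a)"
  assume "a \<noteq> 0" "b \<noteq> 0"
  then obtain n m where n: "residue a n \<noteq> 0" and m: "residue b m \<noteq> 0"
    by (metis padic_int_eqI zero_padic_int.rep_eq)
  let ?x = "residue a (n + m)" and ?y = "residue b (n + m)"
  have p: "prime_elem ?p" using prime_card_int by blast
  have x: "\<not> ?p ^ n dvd ?x"
    using n residue_add_mod[of a n m] by (auto simp: dvd_eq_mod_eq_0)
  have y: "\<not> ?p ^ m dvd ?y"
    using m residue_add_mod[of b m n] by (auto simp: dvd_eq_mod_eq_0 add.commute)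
  have "?x \<noteq> 0" "?y \<noteq> 0" using x y by auto
  moreover have "\<not> is_unit ?p" using p by (rule prime_elem_not_unit)
  ultimately have "multiplicity ?p ?x < n" "multiplicity ?p ?y < m"
    using x y by (auto simp: power_dvd_iff_le_multiplicity not_le)
  moreover have "multiplicity ?p (?x * ?y) = multiplicity ?p ?x + multiplicity ?p ?y"
    using p \<open>?x \<noteq> 0\<close> \<open>?y \<noteq> 0\<close> by (rule prime_elem_multiplicity_mult_distrib)
  ultimately have "\<not> ?p ^ (n + m) dvd ?x * ?y"
    using \<open>?x \<noteq> 0\<close> \<open>?y \<noteq> 0\<close> \<open>\<not> is_unit ?p\<close>
    by (auto simp: power_dvd_iff_le_multiplicity)
  then have "residue (a * b) (n + m) \<noteq> 0"
    by (simp add: times_padic_int.rep_eq dvd_eq_mod_eq_0)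
  then show "a * b \<noteq> 0"
    by (metis zero_padic_int.rep_eq)
qed

type_synonym 'p padic = "'p padic_int fract"


section \<open>The polynomials A, U, V\<close>

text \<open>
  \<open>a j\<close> is the coefficient \<open>a\<^sub>j(n)\<close> as an integer polynomial in \<open>n\<close>. The argument \<open>x\<close> ranges over
  an arbitrary commutative ring; taking \<open>x\<close> to be the indeterminate \<open>[:0, 1:]\<close> in \<open>\<int>[x]\<close> yields
  the polynomials themselves. The leading argument \<open>k\<close> of \<open>A_poly\<close> is the number of coefficients,
  so \<open>A_poly k\<close> is the polynomial with index \<open>k - 1\<close>.
\<close>

definition A_poly :: "nat \<Rightarrow> (nat \<Rightarrow> int poly) \<Rightarrow> nat \<Rightarrow> 'a::comm_ring_1 \<Rightarrow> 'a" where
  "A_poly k a n x = (\<Sum>j<k. of_int (poly (a j) (int n)) * x ^ j)"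

definition U_poly :: "nat \<Rightarrow> (nat \<Rightarrow> int poly) \<Rightarrow> 'a::comm_ring_1 \<Rightarrow> 'a" where
  "U_poly k a x = x * A_poly k a 1 x - A_poly k a 0 x"

definition V_poly :: "nat \<Rightarrow> (nat \<Rightarrow> int poly) \<Rightarrow> 'a::comm_ring_1 \<Rightarrow> 'a" where
  "V_poly k a x = - A_poly k a 0 x"

definition summation_identity ::
    "nat \<Rightarrow> (nat \<Rightarrow> int poly) \<Rightarrow> nat \<Rightarrow> 'a::comm_ring_1 \<Rightarrow> bool" where
  "summation_identity k a N x \<longleftrightarrow>
     (\<Sum>n<N. of_nat (fact n) * (of_nat n ^ k * x ^ k + U_poly k a x) * x ^ n)
       = V_poly k a x + of_nat (fact N) * x ^ N * A_poly k a N x"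

end

(*
  Writing a_k(n) = n^k, the sum telescopes as soon as
  (n + 1) x A(n + 1; x) - A(n; x) - n^k x^k does not depend on n; its value at n = 0 is then U_k(x).
  Comparing coefficients of x^(j+1), it suffices that (n + 1) a_j(n + 1) = a_(j+1)(n) - c_(j+1) with
  c_(j+1) constant, and that a_0 is constant. So, descending from a_k, let a_j be the quotient of
  a_(j+1)(X - 1) by X with the constant term dropped. Each step lowers the degree by one.
*)
theory Submission
  imports Defs
begin

text \<open>An arbitrary \<open>p\<close> replaces the monomial so that the induction can be applied
  to the quotient \<open>q\<close>, which need not be a monomial.\<close>

lemma ex_backward_quotients:
  fixes p :: "'a::comm_ring_1 poly"
  assumes "degree p \<le> k"
  shows "\<exists>a c d. a k = p \<and> (\<forall>m. poly (a 0) m = d) \<and>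
           (\<forall>j<k. \<forall>m. (m + 1) * poly (a j) (m + 1) = poly (a (Suc j)) m - c (Suc j))"
  using assms
proof (induction k arbitrary: p)
  case 0
  then obtain d where "p = [:d:]"
    using degree0_coeffs by blast
  then show ?case
    by (intro exI[of _ "\<lambda>_. p"] exI[of _ "\<lambda>_. 0"] exI[of _ d]) simp
next
  case (Suc k)
  obtain e q where q: "pcompose p [:-1, 1:] = pCons e q"
    by (cases "pcompose p [:-1, 1:]")
  have "degree (pCons e q) \<le> Suc k"
    using degree_pcompose_le[of p "[:-1, 1:]"] Suc.prems unfolding q by simp
  then have "degree q \<le> k"
    by (simp split: if_splits)
  from Suc.IH[OF this] obtain a c d where a: "a k = q" "\<And>m. poly (a 0) m = d"
    "\<And>j m. j < k \<Longrightarrow> (m + 1) * poly (a j) (m + 1) = poly (a (Suc j)) m - c (Suc j)"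
    by blast
  \<comment> \<open>Evaluating at \<open>m + 1\<close> undoes the shift by -1; here \<open>e\<close>
    is the value of \<open>p\<close> at -1.\<close>
  have "(m + 1) * poly q (m + 1) = poly p m - e" for m
    using arg_cong[OF q, of "\<lambda>r. poly r (m + 1)"] by (simp add: poly_pcompose)
  with a show ?case
    by (intro exI[of _ "a(Suc k := p)"] exI[of _ "c(Suc k := e)"] exI[of _ d])
      (auto simp: less_Suc_eq)
qed

lemma summation_identity_if_step:
  fixes x D :: "'a::comm_ring_1"
  assumes "k \<ge> 1"
    and step: "\<And>n. of_nat (Suc n) * x * A_poly k a (Suc n) x
                   = A_poly k a n x + of_nat n ^ k * x ^ k + D"
  shows "summation_identity k a N x"
proof -
  \<comment> \<open>At n = 0 the power \<open>0 ^ k\<close> vanishes because k \<ge> 1, which leaves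
    x A(1; x) = A(0; x) + D.\<close>
  have U: "U_poly k a x = D"
    using step[of 0] \<open>k \<ge> 1\<close> by (simp add: U_poly_def zero_power)
  show ?thesis
    unfolding summation_identity_def U
  proof (induction N)
    case 0
    then show ?case by (simp add: V_poly_def)
  next
    case (Suc N)
    have "of_nat (fact (Suc N)) * x ^ Suc N * A_poly k a (Suc N) x
        = of_nat (fact N) * x ^ N * (of_nat (Suc N) * x * A_poly k a (Suc N) x)"
      by (simp add: algebra_simps)
    then show ?case
      unfolding step using Suc.IH by (simp add: algebra_simps)
  qed
qed

lemma A_poly_step:
  fixes x :: "'a::comm_ring_1"
  assumes ak: "a k = Polynomial.monom 1 k" and a0: "\<And>m. poly (a 0) m = d"
    and a: "\<And>j m. j < k \<Longrightarrow>
              (m + 1) * poly (a j) (m + 1) = poly (a (Suc j)) m - c (Suc j)"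
  shows "of_nat (Suc n) * x * A_poly k a (Suc n) x
       = A_poly k a n x + of_nat n ^ k * x ^ k
         + (- of_int d - (\<Sum>j<k. of_int (c (Suc j)) * x ^ Suc j))"
proof -
  have "of_nat (Suc n) * x * A_poly k a (Suc n) x
      = (\<Sum>j<k. of_int ((int n + 1) * poly (a j) (int n + 1)) * x ^ Suc j)"
    unfolding A_poly_def sum_distrib_left
    by (intro sum.cong refl) (simp add: algebra_simps)
  also have "\<dots> = (\<Sum>j<k. of_int (poly (a (Suc j)) (int n)) * x ^ Suc j)
                - (\<Sum>j<k. of_int (c (Suc j)) * x ^ Suc j)"
    unfolding sum_subtractf[symmetric]
    by (intro sum.cong refl) (simp add: a left_diff_distrib)
  \<comment> \<open>The shifted sum runs over the exponents 1 to k; only the constant term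
    \<open>d\<close> is missing from \<open>A_poly (Suc k)\<close>, whose top term is n^k
    x^k.\<close>
  also have "(\<Sum>j<k. of_int (poly (a (Suc j)) (int n)) * x ^ Suc j)
           = A_poly (Suc k) a n x - of_int d"
    unfolding A_poly_def sum.lessThan_Suc_shift by (simp add: a0)
  also have "A_poly (Suc k) a n x = A_poly k a n x + of_nat n ^ k * x ^ k"
    by (simp add: A_poly_def ak Polynomial.poly_monom)
  finally show ?thesis
    by (simp add: algebra_simps)
qed

theorem theorem1:
  fixes k :: nat
  assumes "k \<ge> 1"
  shows "\<exists>a :: nat \<Rightarrow> int poly.
           (\<forall>N. summation_identity k a N ([:0, 1:] :: int poly)) \<and>
           (\<forall>N. \<forall>x :: real. summation_identity k a N x) \<and>
           (\<forall>N. \<forall>x :: 'p::prime_card padic. summation_identity k a N x)"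
proof -
  obtain a c d where "a k = Polynomial.monom (1 :: int) k" "\<And>m. poly (a 0) m = d"
    "\<And>j m. j < k \<Longrightarrow> (m + 1) * poly (a j) (m + 1) = poly (a (Suc j)) m - c (Suc j)"
    using ex_backward_quotients[of "Polynomial.monom (1 :: int) k" k] Polynomial.degree_monom_le by blast
  \<comment> \<open>The integer data \<open>a\<close>, \<open>c\<close>, \<open>d\<close> are fixed
    before any ring is chosen, so \<open>step\<close> stays polymorphic in \<open>x\<close> and one
    \<open>a\<close> serves all three rings.\<close>
  note step = summation_identity_if_step[OF assms A_poly_step[OF this]]
  show ?thesis
    by (intro exI[of _ a] conjI allI step)
qed

end
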